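(* One can define a (deterministic) $V$-super uniformly dispersed sequence in $\mathbb{T}=\mathbb{R}/\mathbb{Z}$ with $$V(\epsilon)=O\left(\epsilon^{-2}\cdot 2^{O\left(\sqrt{-\ln(\epsilon)}\right)}\right).$$ As a consequence, one can construct a (deterministic) dense forest in the plane of the form $\mathfrak{F}(\boldsymbol{a})$, for a sequence $\boldsymbol{a}=(a_n)_{n\in\mathbb{N}}$ in $\mathbb{T}$, with visibility $O\left(\epsilon^{-2}\cdot 2^{O\left(\sqrt{-\ln(\epsilon)}\right)}\right)$.
   Context: $\mathbb{N}$ is the set of positive integers, $\mathbb{N}_0$ the set of non-negative integers, $\mathbb{R}^+$ the positive reals. For $x\in\mathbb{R}$ (or $x\in\mathbb{T}$), $\|x\|$ is the distance from $x$ to the nearest integer. For real $N$, $[\![N]\!]=\{n\in\mathbb{Z}:1\le n\le N\}$. For a sequence $\boldsymbol{a}=(a_n)_{n\in\mathbb{N}}$ in $\mathbb{T}$ put $$\Delta_{\boldsymbol{a}}(N)=\sup_{m\in\mathbb{N}_0}\ \sup_{\xi\in\mathbb{T}}\ \sup_{x\in\mathbb{T}}\ \min_{i\in[\![N]\!]}\ \|x-(a_{i+m}-i\xi)\|.$$ For $V:(0,1]\to\mathbb{R}^{+}$, the sequence $\boldsymbol{a}$ is $V$-super uniformly dispersed if $\Delta_{\boldsymbol{a}}(V(\epsilon))\le\epsilon$ for every $\epsilon\in(0,1]$, that is, for any $m\in\mathbb{N}_0$ and $x,\xi\in\mathbb{T}$ there exists $n\in[\![V(\epsilon)]\!]$ with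 $\|x-(a_{n+m}-n\xi)\|\le\epsilon$. Define $\mathfrak{F}(\boldsymbol{a})=\mathfrak{F}_1(\boldsymbol{a})\cup\mathfrak{F}_2(\boldsymbol{a})\subseteq\mathbb{R}^2$, where (identifying each $a_n$ with any real representative) $\mathfrak{F}_1(\boldsymbol{a})=\{(k,a_{|k|}+l):k\in\mathbb{Z}\setminus\{0\},\ l\in\mathbb{Z}\}$ and $\mathfrak{F}_2(\boldsymbol{a})$ is the image of $\mathfrak{F}_1(\boldsymbol{a})$ under the rotation by $\pi/2$ about the origin. A set $\mathfrak{F}\subseteq\mathbb{R}^{2}$ is a dense forest with visibility function $W$ if (i) it has finite density, i.e. the number of its points in the Euclidean ball of radius $T$ about the origin is $O(T^2)$, and (ii) $W:(0,1)\to\mathbb{R}^{+}$ is a decreasing (i.e. non-increasing) function tending to $+\infty$ as $\epsilon\to0^{+}$ such that for any $\epsilon\in(0,1)$ and any line segment $L\subseteq\mathbb{R}^{2}$ of length $W(\epsilon)$ there is $x\in\mathfrak{F}$ at Euclidean distance at most $\epsilon$ from $L$. It has visibility $O(g(\epsilon))$ if it admits a visibility function $W$ with $W(\epsilon)=O(g(\epsilon))$. The bound $f(\epsilon)=O(\epsilon^{-2}2^{O(\sqrt{-\ln\epsilon})})$ means that there are constants $C,C'>0$ with $f(\epsilon)\le C\,\epsilon^{-2}\,2^{C'\sqrt{-\ln\epsilon}}$ for every $\epsilon$ in the domain. "Deterministic" means specified without any random choice. *)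

theory Defs
  imports "HOL-Analysis.Analysis" "HOL-Library.Landau_Symbols"
begin

text \<open>
  A point of the circle \<open>\<real>/\<int>\<close> is given by a real representative; everything below depends only on
  the class modulo 1. Sequences are indexed by the positive integers: the value \<open>a 0\<close> is never used.
\<close>

definition nint_dist :: "real \<Rightarrow> real" where
  "nint_dist x = \<bar>x - of_int (round x)\<bar>"

text \<open>
  The infimum is a minimum over a finite set, except for \<open>N < 1\<close>, where the index set is empty and
  the value is \<open>\<infinity>\<close>; this is why the dispersion is an extended real.
\<close>

definition super_dispersion :: "(nat \<Rightarrow> real) \<Rightarrow> real \<Rightarrow> ereal" where
  "super_dispersion a N =
     (SUP m::nat. SUP \<xi>::real. SUP x::real.
        INF i\<in>{i::nat. 1 \<le> i \<and> real i \<le> N}. ereal (nint_dist (x - (a (i + m) - real i * \<xi>))))"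

definition super_uniformly_dispersed :: "(real \<Rightarrow> real) \<Rightarrow> (nat \<Rightarrow> real) \<Rightarrow> bool" where
  "super_uniformly_dispersed V a \<longleftrightarrow>
     (\<forall>\<epsilon>\<in>{0<..1}. V \<epsilon> > 0) \<and>
     (\<forall>\<epsilon>\<in>{0<..1}. super_dispersion a (V \<epsilon>) \<le> ereal \<epsilon>)"

definition forest1 :: "(nat \<Rightarrow> real) \<Rightarrow> (real \<times> real) set" where
  "forest1 a = {(of_int k, a (nat \<bar>k\<bar>) + of_int l) | k l :: int. k \<noteq> 0}"

definition forest2 :: "(nat \<Rightarrow> real) \<Rightarrow> (real \<times> real) set" where
  "forest2 a = (\<lambda>(x, y). (- y, x)) ` forest1 a"

definition forest :: "(nat \<Rightarrow> real) \<Rightarrow> (real \<times> real) set" where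
  "forest a = forest1 a \<union> forest2 a"

definition finite_density :: "(real \<times> real) set \<Rightarrow> bool" where
  "finite_density F \<longleftrightarrow>
     (\<forall>T. finite (F \<inter> cball 0 T)) \<and>
     (\<lambda>T. real (card (F \<inter> cball 0 T))) \<in> O[at_top](\<lambda>T. T ^ 2)"

definition visibility_function :: "(real \<times> real) set \<Rightarrow> (real \<Rightarrow> real) \<Rightarrow> bool" where
  "visibility_function F W \<longleftrightarrow>
     (\<forall>\<epsilon>\<in>{0<..<1}. W \<epsilon> > 0) \<and>
     antimono_on {0<..<1} W \<and>
     filterlim W at_top (at_right 0) \<and>
     (\<forall>\<epsilon>\<in>{0<..<1}. \<forall>p q. dist p q = W \<epsilon> \<longrightarrow> (\<exists>x\<in>F. infdist x (closed_segment p q) \<le> \<epsilon>))"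

definition dense_forest :: "(real \<times> real) set \<Rightarrow> (real \<Rightarrow> real) \<Rightarrow> bool" where
  "dense_forest F W \<longleftrightarrow> finite_density F \<and> visibility_function F W"

text \<open>
  The bound \<open>f(\<epsilon>) = O(\<epsilon>\<^sup>-\<^sup>2 2\<^bsup>O(\<surd>(-ln \<epsilon>))\<^esup>)\<close>, with constants that are uniform over the domain \<open>D\<close> of \<open>f\<close>.
\<close>

definition near_inverse_square :: "real set \<Rightarrow> (real \<Rightarrow> real) \<Rightarrow> bool" where
  "near_inverse_square D f \<longleftrightarrow>
     (\<exists>C>0. \<exists>C'>0. \<forall>\<epsilon>\<in>D. f \<epsilon> \<le> C * \<epsilon> powr (-2) * 2 powr (C' * sqrt (- ln \<epsilon>)))"

lemma super_dispersion_le_iff: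
  "super_dispersion a N \<le> ereal \<epsilon> \<longleftrightarrow>
     (\<forall>m \<xi> x. \<exists>n\<ge>1. real n \<le> N \<and> nint_dist (x - (a (n + m) - real n * \<xi>)) \<le> \<epsilon>)"
proof -
  have *: "(INF i\<in>{i::nat. 1 \<le> i \<and> real i \<le> N}. ereal (f i)) \<le> ereal \<epsilon> \<longleftrightarrow>
      (\<exists>n\<ge>1. real n \<le> N \<and> f n \<le> \<epsilon>)" (is "Inf (?g ` ?I) \<le> _ \<longleftrightarrow> _") for f
  proof
    assume le: "Inf (?g ` ?I) \<le> ereal \<epsilon>"
    have fin: "finite ?I"
      by (rule finite_subset[of _ "{..nat \<lfloor>N\<rfloor>}"]) (auto simp: le_nat_floor)
    have ne: "?I \<noteq> {}"
    proof
      assume "?I = {}"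
      then have "Inf (?g ` ?I) = \<infinity>" by (simp only: image_empty Inf_empty top_ereal_def)
      with le show False by (simp only: ereal_infty_less_eq(1)) simp
    qed
    have "Inf (?g ` ?I) \<in> ?g ` ?I"
    proof -
      have "Min (?g ` ?I) \<in> ?g ` ?I" by (rule Min_in) (use fin ne in simp_all)
      moreover have "Min (?g ` ?I) = Inf (?g ` ?I)" by (rule Min_Inf) (use fin ne in simp_all)
      ultimately show ?thesis by (simp only:)
    qed
    with le show "\<exists>n\<ge>1. real n \<le> N \<and> f n \<le> \<epsilon>" by auto
  next
    assume "\<exists>n\<ge>1. real n \<le> N \<and> f n \<le> \<epsilon>"
    then obtain n where "n \<in> ?I" "f n \<le> \<epsilon>" by auto
    then show "Inf (?g ` ?I) \<le> ereal \<epsilon>" by (intro INF_lower2[of n]) auto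
  qed
  show ?thesis
    unfolding super_dispersion_def SUP_le_iff * by blast
qed

end

theory Submission
  imports Defs
begin

text \<open>
  Completing the square, \<open>n\<^sup>2/R\<^sup>2 - n\<xi> = (n - t)\<^sup>2/R\<^sup>2 - t\<^sup>2/R\<^sup>2\<close> with \<open>t = R\<^sup>2\<xi>/2\<close>, and replacing \<open>\<xi>\<close> by
  \<open>\<xi> + l\<close> moves \<open>t\<close> by a multiple of \<open>R\<^sup>2/2\<close>, hence into any window of that length. As \<open>n\<close> runs from \<open>t\<close>
  to \<open>t + R\<close> the square climbs from 0 to 1 in steps \<open>O(1/R)\<close>. So the sequence \<open>n\<^sup>2/R\<^sup>2\<close> is dispersed at
  the scale \<open>1/R\<close> on all windows of length \<open>O(R\<^sup>2)\<close>. To serve all scales at once, the positions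
  \<open>2\<^sup>k(2j + 1)\<close> carry the sequence \<open>j\<^sup>2/R\<^sup>2\<close> with \<open>R\<close> of order \<open>exp (k\<^sup>2)\<close>: the sparsity of the positions
  and the ratio of consecutive scales both cost only a factor \<open>exp (O(k)) = 2\<^bsup>O(\<surd>(-ln \<epsilon>))\<^esup>\<close>.
\<close>

section \<open>Dispersion of a quadratic sequence at one fixed scale\<close>

lemma nint_dist_le: "nint_dist x \<le> \<bar>x - of_int l\<bar>"
  unfolding nint_dist_def by (rule round_diff_minimal)

lemma quadratic_dispersed:
  fixes R x \<xi> :: real and M :: nat
  assumes R: "R \<ge> 1"
  shows "\<exists>n\<ge>M. real n \<le> real M + 3 * R\<^sup>2 \<and> nint_dist (x - ((real n)\<^sup>2 / R\<^sup>2 - real n * \<xi>)) \<le> 3 / R"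
proof -
  \<comment> \<open>The choice of \<open>l\<close> puts the centre \<open>t\<close> of the completed
    square into the interval from \<open>M\<close> to \<open>M + R^2 / 2\<close>, so that every n
    above \<open>t\<close> is admissible.\<close>
  define l where "l = \<lceil>2 * real M / R\<^sup>2 - \<xi>\<rceil>"
  define t where "t = R\<^sup>2 * (\<xi> + of_int l) / 2"
  have R2: "R\<^sup>2 > 0" and RR: "R \<le> R\<^sup>2" "1 \<le> R\<^sup>2"
    using R by (auto simp: power2_eq_square mult_ge1_I)
  have "2 * real M / R\<^sup>2 \<le> \<xi> + of_int l" "\<xi> + of_int l \<le> 2 * real M / R\<^sup>2 + 1"
    unfolding l_def by linarith+
  then have t: "real M \<le> t" "t \<le> real M + R\<^sup>2 / 2"
    unfolding t_def using R2 by (auto simp: field_simps)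
  \<comment> \<open>Modulo 1, the square (n - t)^2 / R^2 has to come close to \<open>z\<close>; its
    representative \<open>y\<close> in [0, 1) is reached no later than t + R.\<close>
  define z where "z = x + t\<^sup>2 / R\<^sup>2"
  define y where "y = frac z"
  have y: "0 \<le> y" "y < 1" unfolding y_def by (auto simp: frac_lt_1)
  then have sy: "0 \<le> sqrt y" "sqrt y \<le> 1" by auto
  \<comment> \<open>The exact solution of (n - t)^2 / R^2 = y is t + R sqrt y; it is rounded up, and
    \<open>s\<close> is the rounding error.\<close>
  define n where "n = nat \<lceil>t + R * sqrt y\<rceil>"
  have nonneg: "0 \<le> t + R * sqrt y" using t(1) sy R by simp
  define s where "s = real n - t - R * sqrt y"
  have s: "0 \<le> s" "s \<le> 1"
    unfolding s_def n_def using nonneg by linarith+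
  have Rsy: "0 \<le> R * sqrt y" "R * sqrt y \<le> R" using sy R by (auto simp: mult_left_le)
  have 1: "n \<ge> M" using s Rsy t(1) unfolding s_def by linarith
  have 2: "real n \<le> real M + 3 * R\<^sup>2" using s Rsy t(2) RR unfolding s_def by linarith
  have n_eq: "real n = t + R * sqrt y + s" unfolding s_def by simp
  have "(real n)\<^sup>2 / R\<^sup>2 - real n * \<xi> = (real n - t)\<^sup>2 / R\<^sup>2 - t\<^sup>2 / R\<^sup>2 + real n * of_int l"
  proof -
    have xi: "\<xi> = 2 * t / R\<^sup>2 - of_int l" unfolding t_def using R by simp
    have "real n * \<xi> = 2 * real n * t / R\<^sup>2 - real n * of_int l"
      unfolding xi by (simp add: algebra_simps)
    moreover have "(real n - t)\<^sup>2 / R\<^sup>2 = (real n)\<^sup>2 / R\<^sup>2 - 2 * real n * t / R\<^sup>2 + t\<^sup>2 / R\<^sup>2"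
      by (simp add: power2_diff diff_divide_distrib add_divide_distrib)
    ultimately show ?thesis by simp
  qed
  moreover have "(real n - t)\<^sup>2 / R\<^sup>2 = y + (2 * sqrt y * s / R + s\<^sup>2 / R\<^sup>2)"
  proof -
    have "(real n - t)\<^sup>2 = R\<^sup>2 * (sqrt y)\<^sup>2 + 2 * R * sqrt y * s + s\<^sup>2"
      unfolding n_eq by (simp add: power2_eq_square algebra_simps)
    then show ?thesis using R y(1) by (simp add: field_simps power2_eq_square)
  qed
  \<comment> \<open>Since y and z differ by an integer, and so does n * l from 0, only the effect of
    rounding remains. Its two terms are at most 2/R and 1/R.\<close>
  ultimately have eq: "x - ((real n)\<^sup>2 / R\<^sup>2 - real n * \<xi>) - of_int (\<lfloor>z\<rfloor> - int n * l)
      = - (2 * sqrt y * s / R + s\<^sup>2 / R\<^sup>2)"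
    unfolding y_def z_def frac_def by simp
  have "2 * sqrt y * s / R \<le> 2 / R"
    using R sy s by (intro divide_right_mono) (auto simp: mult_le_one)
  moreover have "s\<^sup>2 / R\<^sup>2 \<le> 1 / R"
    using R s RR by (intro frac_le) (auto simp: power_le_one)
  moreover have "0 \<le> 2 * sqrt y * s / R + s\<^sup>2 / R\<^sup>2" using sy s R by simp
  ultimately have "\<bar>- (2 * sqrt y * s / R + s\<^sup>2 / R\<^sup>2)\<bar> \<le> 3 / R" by simp
  then have "nint_dist (x - ((real n)\<^sup>2 / R\<^sup>2 - real n * \<xi>)) \<le> 3 / R"
    using nint_dist_le eq order_trans by metis
  with 1 2 show ?thesis by blast
qed

section \<open>One sequence for all scales\<close>

definition resolution :: "nat \<Rightarrow> real" where
  "resolution k = 3 * exp ((real k)\<^sup>2)"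

text \<open>For n = 2^k (2 j + 1) the division returns j, so the exponent of 2 in n selects the
  scale and the odd part selects the term.\<close>

definition dispersed_seq :: "nat \<Rightarrow> real" where
  "dispersed_seq n = (let k = multiplicity 2 n in (real (n div 2 ^ Suc k))\<^sup>2 / (resolution k)\<^sup>2)"

lemma dispersed_seq_eq: "dispersed_seq (2 ^ k * (2 * j + 1)) = (real j)\<^sup>2 / (resolution k)\<^sup>2"
proof -
  have "multiplicity 2 (2 ^ k * (2 * j + 1)) = k"
  proof (rule multiplicity_eqI)
    show "\<not> 2 ^ Suc k dvd 2 ^ k * (2 * j + 1)"
      unfolding power_Suc2 nat_mult_dvd_cancel_disj by simp
  qed simp
  moreover have "2 ^ k * (2 * j + 1) div 2 ^ Suc k = j"
    by (simp add: algebra_simps)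
  ultimately show ?thesis unfolding dispersed_seq_def Let_def by simp
qed

text \<open>Along the positions i + m = 2^k (2 j + 1) the term i * \<xi> is affine in j with slope
  2^(k+1) * \<xi>. The one-scale result therefore applies with this slope, once the constant part
  \<open>c\<close> is absorbed into the target.\<close>

lemma dispersed_seq_resolution:
  "\<exists>i\<ge>1. real i \<le> 2 ^ Suc k * (5 * (resolution k)\<^sup>2) \<and>
     nint_dist (x - (dispersed_seq (i + m) - real i * \<xi>)) \<le> 3 / resolution k"
proof -
  let ?q = "2 ^ Suc k :: nat"
  \<comment> \<open>The least \<open>M\<close> with 2^(k+1) M > m; it forces i \<ge> 1 for every j
    \<ge> M.\<close>
  define M where "M = m div ?q + 1"
  define c where "c = (2 ^ k - real m) * \<xi>"
  have "exp ((real k)\<^sup>2) \<ge> 1" by simp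
  then have R: "resolution k \<ge> 1" unfolding resolution_def by linarith
  obtain j where j: "j \<ge> M" "real j \<le> real M + 3 * (resolution k)\<^sup>2"
    and d: "nint_dist ((x + c) - ((real j)\<^sup>2 / (resolution k)\<^sup>2 - real j * (2 ^ Suc k * \<xi>))) \<le> 3 / resolution k"
    using quadratic_dispersed[OF R] by blast
  have "m < ?q * M" unfolding M_def
    using dividend_less_times_div[of ?q m] by (simp add: algebra_simps)
  moreover have "?q * M \<le> ?q * j" using j(1) by (rule mult_le_mono2)
  ultimately have mj: "m < ?q * j" by linarith
  have qM: "?q * M \<le> m + ?q"
    unfolding M_def add_mult_distrib2 using times_div_less_eq_dividend[of ?q m] by linarith
  define i where "i = 2 ^ k * (2 * j + 1) - m"
  have im: "i + m = 2 ^ k * (2 * j + 1)" and "i \<ge> 1"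
    using mj unfolding i_def by (auto simp: algebra_simps)
  have ri: "real i = 2 ^ Suc k * real j + 2 ^ k - real m"
    using arg_cong[OF im, of real] by (simp add: algebra_simps)
  \<comment> \<open>The constant 5 is 3 from the one-scale window, 1 from rounding m up to a
    multiple of 2^(k+1), and 1 for the offset 2^k.\<close>
  have "2 ^ Suc k * real j \<le> 2 ^ Suc k * (real M + 3 * (resolution k)\<^sup>2)"
    using j(2) by (intro mult_left_mono) auto
  moreover have "2 ^ Suc k * real M \<le> real m + 2 ^ Suc k"
    using qM of_nat_mono[OF qM, where 'a=real] by simp
  moreover have "(2::real) ^ Suc k * 1 \<le> 2 ^ Suc k * (resolution k)\<^sup>2"
    using R by (intro mult_left_mono) auto
  moreover have "(2::real) ^ k \<le> 2 ^ Suc k" by simp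
  ultimately have ub: "real i \<le> 2 ^ Suc k * (5 * (resolution k)\<^sup>2)"
    unfolding ri by (simp only: distrib_left mult.left_commute[of "2 ^ Suc k"])
  have eq: "x - (dispersed_seq (i + m) - real i * \<xi>)
      = (x + c) - ((real j)\<^sup>2 / (resolution k)\<^sup>2 - real j * (2 ^ Suc k * \<xi>))"
    unfolding im dispersed_seq_eq ri c_def by (simp add: algebra_simps)
  show ?thesis using ub d[folded eq] \<open>i \<ge> 1\<close> by blast
qed

text \<open>With u = sqrt (- ln \<epsilon>) and k \<le> u + 1, the exponent bounds k + 2 k^2, since
  (u + 1) + 2 (u + 1)^2 = 3 + 2 u^2 + 5 u. The factor 90 is 2 * 5 * 3^2.\<close>

definition window :: "real \<Rightarrow> real" where
  "window \<epsilon> = 90 * exp (3 - 2 * ln \<epsilon> + 5 * sqrt (- ln \<epsilon>))"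

lemma window_pos: "window \<epsilon> > 0"
  unfolding window_def by simp

lemma super_uniformly_dispersed_seq: "super_uniformly_dispersed window dispersed_seq"
  unfolding super_uniformly_dispersed_def super_dispersion_le_iff
proof (intro conjI ballI allI)
  fix \<epsilon> :: real and m :: nat and \<xi> x :: real
  assume "\<epsilon> \<in> {0<..1}"
  then have eps: "0 < \<epsilon>" "ln \<epsilon> \<le> 0" by auto
  define u where "u = sqrt (- ln \<epsilon>)"
  have u: "u \<ge> 0" "u\<^sup>2 = - ln \<epsilon>" unfolding u_def using eps by auto
  \<comment> \<open>The first scale with k^2 \<ge> - ln \<epsilon>: fine enough for \<epsilon>, and
    overshooting u by at most 1.\<close>
  define k where "k = nat \<lceil>u\<rceil>"
  have k: "u \<le> real k" "real k \<le> u + 1" unfolding k_def using u(1) by linarith+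
  obtain i where i: "i \<ge> 1" "real i \<le> 2 ^ Suc k * (5 * (resolution k)\<^sup>2)"
    and d: "nint_dist (x - (dispersed_seq (i + m) - real i * \<xi>)) \<le> 3 / resolution k"
    using dispersed_seq_resolution by blast
  have "u\<^sup>2 \<le> (real k)\<^sup>2" using k(1) u(1) by (rule power_mono)
  then have "exp (- (real k)\<^sup>2) \<le> exp (ln \<epsilon>)" using u(2) by simp
  \<comment> \<open>The 3 in \<open>resolution\<close> cancels the 3 of the one-scale bound and
    leaves exp (- k^2).\<close>
  then have small: "3 / resolution k \<le> \<epsilon>" using eps by (simp add: resolution_def exp_minus field_simps)
  have "(real k)\<^sup>2 \<le> (u + 1)\<^sup>2" using k(2) by (rule power_mono) simp
  then have ksq: "(real k)\<^sup>2 \<le> - ln \<epsilon> + 2 * u + 1" using u(2) by (simp add: power2_sum)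
  have "(2::real) ^ k \<le> exp 1 ^ k" using exp_ge_add_one_self[of 1] by (intro power_mono) auto
  also have "\<dots> = exp (real k)" by (simp add: exp_of_nat_mult[symmetric])
  finally have "2 ^ Suc k * (5 * (resolution k)\<^sup>2) \<le> 90 * (exp (real k) * (exp ((real k)\<^sup>2))\<^sup>2)"
    by (simp add: resolution_def power_mult_distrib)
  also have "\<dots> = 90 * exp (real k + 2 * (real k)\<^sup>2)"
    by (simp add: exp_add exp_double)
  also have "\<dots> \<le> window \<epsilon>"
    unfolding window_def u_def[symmetric] using k(2) ksq by simp
  finally have "real i \<le> window \<epsilon>" using i(2) by simp
  then show "\<exists>n\<ge>1. real n \<le> window \<epsilon> \<and> nint_dist (x - (dispersed_seq (n + m) - real n * \<xi>)) \<le> \<epsilon>"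
    using i(1) d small by (intro exI[of _ i]) simp
qed (rule window_pos)

section \<open>Growth of the window bound\<close>

lemma near_inverse_square_window:
  assumes "D \<subseteq> {0<..1}" "c > 0"
  shows "near_inverse_square D (\<lambda>\<epsilon>. c * window \<epsilon>)"
  unfolding near_inverse_square_def
proof (intro exI conjI ballI)
  fix \<epsilon> assume "\<epsilon> \<in> D"
  then have eps: "0 < \<epsilon>" "\<epsilon> \<le> 1" using assms by auto
  \<comment> \<open>Passing from base e to base 2 turns the coefficient 5 into 10, because ln 2
    \<ge> 1/2.\<close>
  have ln2: "ln 2 \<ge> (1/2::real)" using ln2_ge_two_thirds by simp
  have "5 * sqrt (- ln \<epsilon>) \<le> 10 * sqrt (- ln \<epsilon>) * ln 2"
    using mult_left_mono[OF ln2, of "10 * sqrt (- ln \<epsilon>)"] eps by simp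
  then have "exp (5 * sqrt (- ln \<epsilon>)) \<le> 2 powr (10 * sqrt (- ln \<epsilon>))"
    by (simp add: powr_def)
  moreover have "\<epsilon> powr (-2) = exp (- 2 * ln \<epsilon>)" using eps by (simp add: powr_def)
  moreover have "c * window \<epsilon> = c * 90 * exp 3 * exp (- 2 * ln \<epsilon>) * exp (5 * sqrt (- ln \<epsilon>))"
    unfolding window_def by (simp flip: exp_add)
  ultimately show "c * window \<epsilon> \<le> c * 90 * exp 3 * \<epsilon> powr (-2) * 2 powr (10 * sqrt (- ln \<epsilon>))"
    using assms(2) by simp
qed (use assms(2) in auto)

lemma antimono_window: "antimono_on {0<..<1} window"
  unfolding window_def by (rule monotone_onI) (auto simp: add_mono)

lemma filterlim_window: "filterlim window at_top (at_right 0)"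
proof (rule filterlim_at_top_mono)
  show "filterlim (\<lambda>\<epsilon>::real. inverse \<epsilon>) at_top (at_right 0)"
    by (rule filterlim_inverse_at_top_right)
  have "inverse \<epsilon> \<le> window \<epsilon>" if "\<epsilon> \<in> {0<..<1}" for \<epsilon> :: real
  proof -
    have "inverse \<epsilon> = exp (- ln \<epsilon>)" using that by (simp add: exp_minus)
    also have "\<dots> \<le> exp (3 - 2 * ln \<epsilon> + 5 * sqrt (- ln \<epsilon>))"
    proof -
      have "ln \<epsilon> \<le> 0" using that by simp
      moreover from this have "0 \<le> sqrt (- ln \<epsilon>)" by simp
      ultimately have "- ln \<epsilon> \<le> 3 - 2 * ln \<epsilon> + 5 * sqrt (- ln \<epsilon>)" by linarith
      then show ?thesis by simp
    qed
    also have "\<dots> \<le> window \<epsilon>" unfolding window_def by simp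
    finally show ?thesis .
  qed
  then show "eventually (\<lambda>\<epsilon>. inverse \<epsilon> \<le> window \<epsilon>) (at_right 0)"
    using eventually_at_right_real[of 0 1] by (auto elim: eventually_mono)
qed

section \<open>Finite density of the forest\<close>

lemma norm_rotate: "norm (- y, x) = norm (x, y)" for x y :: real
  by (simp add: norm_prod_def add.commute)

text \<open>Each unit cell with integer corners holds at most one point: the first coordinate is an
  integer and determines the column, and points of one column differ by integers. So counting points
  reduces to counting cells.\<close>

lemma forest1_card_bound:
  "finite (forest1 a \<inter> cball 0 T)"
  "card (forest1 a \<inter> cball 0 T) \<le> (nat (2 * \<lceil>T\<rceil> + 2))\<^sup>2"
proof -
  let ?I = "{- \<lceil>T\<rceil> - 1..\<lceil>T\<rceil>}"
  let ?f = "\<lambda>(x::real, y::real). (\<lfloor>x\<rfloor>, \<lfloor>y\<rfloor>)"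
  have inj: "inj_on ?f (forest1 a \<inter> cball 0 T)"
  proof (rule inj_onI, clarify)
    fix x y x' y' assume "(x, y) \<in> forest1 a" "(x', y') \<in> forest1 a"
    then obtain k l k' l' :: int where
      x: "x = of_int k" "x' = of_int k'" and
      y: "y = a (nat \<bar>k\<bar>) + of_int l" "y' = a (nat \<bar>k'\<bar>) + of_int l'"
      unfolding forest1_def by blast
    assume "\<lfloor>x\<rfloor> = \<lfloor>x'\<rfloor>" "\<lfloor>y\<rfloor> = \<lfloor>y'\<rfloor>"
    then show "x = x' \<and> y = y'" unfolding x y by simp
  qed
  have sub: "?f ` (forest1 a \<inter> cball 0 T) \<subseteq> ?I \<times> ?I"
  proof clarify
    fix x y assume "(x, y) \<in> cball (0 :: real \<times> real) T"
    then have "norm (x, y) \<le> T" by simp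
    then have "\<bar>x\<bar> \<le> T" "\<bar>y\<bar> \<le> T"
      using norm_fst_le[of x y] norm_snd_le[of y x] unfolding real_norm_def by linarith+
    then show "\<lfloor>x\<rfloor> \<in> ?I \<and> \<lfloor>y\<rfloor> \<in> ?I" unfolding atLeastAtMost_iff by linarith
  qed
  have fin: "finite (?I \<times> ?I)" by simp
  show "finite (forest1 a \<inter> cball 0 T)"
    using inj_on_finite[OF inj sub fin] .
  have "card (forest1 a \<inter> cball 0 T) \<le> card (?I \<times> ?I)"
    by (rule card_inj_on_le[OF inj sub fin])
  also have "\<dots> = (nat (2 * \<lceil>T\<rceil> + 2))\<^sup>2"
    by (simp add: card_cartesian_product power2_eq_square add.commute)
  finally show "card (forest1 a \<inter> cball 0 T) \<le> (nat (2 * \<lceil>T\<rceil> + 2))\<^sup>2" .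
qed

lemma finite_density_forest: "finite_density (forest a)"
proof -
  have eq: "forest a \<inter> cball 0 T
      = forest1 a \<inter> cball 0 T \<union> (\<lambda>(x, y). (- y, x)) ` (forest1 a \<inter> cball 0 T)" for T
    unfolding forest_def forest2_def by (auto simp: norm_rotate)
  have fin: "finite (forest a \<inter> cball 0 T)" for T
    unfolding eq using forest1_card_bound(1) by simp
  have card: "card (forest a \<inter> cball 0 T) \<le> 2 * (nat (2 * \<lceil>T\<rceil> + 2))\<^sup>2" for T
  proof -
    let ?F = "forest1 a \<inter> cball 0 T"
    have "card (forest a \<inter> cball 0 T) \<le> card ?F + card ((\<lambda>(x, y). (- y, x)) ` ?F)"
      unfolding eq by (rule card_Un_le)
    also have "\<dots> \<le> card ?F + card ?F"
      using card_image_le[OF forest1_card_bound(1)] by (rule add_left_mono)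
    also have "\<dots> \<le> 2 * (nat (2 * \<lceil>T\<rceil> + 2))\<^sup>2"
      using forest1_card_bound(2)[of a T] by linarith
    finally show ?thesis .
  qed
  have "(\<lambda>T. real (card (forest a \<inter> cball 0 T))) \<in> O[at_top](\<lambda>T. T ^ 2)"
  \<comment> \<open>For T \<ge> 1 the side 2 \<lceil>T\<rceil> + 2 is at most 6 T, and the two
    halves of the forest give 2 * 6^2.\<close>
  proof (rule bigoI[where c = 72])
    have "real (card (forest a \<inter> cball 0 T)) \<le> 72 * T\<^sup>2" if "T \<ge> 1" for T
    proof -
      have "real (nat (2 * \<lceil>T\<rceil> + 2)) \<le> 6 * T" using that by linarith
      then have "(real (nat (2 * \<lceil>T\<rceil> + 2)))\<^sup>2 \<le> (6 * T)\<^sup>2" by (rule power_mono) simp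
      moreover have "real (card (forest a \<inter> cball 0 T)) \<le> 2 * (real (nat (2 * \<lceil>T\<rceil> + 2)))\<^sup>2"
        using of_nat_mono[OF card[of T], where 'a=real] by simp
      ultimately show ?thesis by (simp add: power_mult_distrib)
    qed
    then show "\<forall>\<^sub>F T in at_top. norm (real (card (forest a \<inter> cball 0 T))) \<le> 72 * norm (T ^ 2)"
      by (intro eventually_mono[OF eventually_ge_at_top[of 1]]) simp
  qed
  with fin show ?thesis unfolding finite_density_def by blast
qed

section \<open>From dispersion to visibility\<close>

lemma forest1_hits_line_right:
  fixes V :: "real \<Rightarrow> real" and a :: "nat \<Rightarrow> real" and c s u :: real
  assumes sud: "super_uniformly_dispersed V a" and eps: "\<epsilon> \<in> {0<..1}" and u: "0 \<le> u"
  shows "\<exists>k::int. 0 < k \<and> u \<le> of_int k \<and> of_int k \<le> u + V \<epsilon> \<and>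
           (\<exists>l::int. \<bar>(c + s * k) - (a (nat k) + l)\<bar> \<le> \<epsilon>)"
proof -
  \<comment> \<open>The slope \<open>s\<close> plays the role of \<xi> and \<open>m\<close> that of
    the shift: at k = i + m, the height of the line minus a(k) is (c + s m) - (a(i + m) - i s). As i
    \<ge> 1, k lies beyond \<open>u\<close>.\<close>
  define m where "m = nat \<lfloor>u\<rfloor>"
  have m: "real m \<le> u" "u < real m + 1" unfolding m_def using u by linarith+
  obtain i where i: "i \<ge> 1" "real i \<le> V \<epsilon>"
    and d: "nint_dist ((c + s * real m) - (a (i + m) - real i * s)) \<le> \<epsilon>"
    using sud eps unfolding super_uniformly_dispersed_def super_dispersion_le_iff by blast
  obtain l :: int where "\<bar>((c + s * real m) - (a (i + m) - real i * s)) - l\<bar> \<le> \<epsilon>"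
    using d unfolding nint_dist_def by blast
  then have "\<bar>(c + s * real_of_int (int (i + m))) - (a (nat (int (i + m))) + l)\<bar> \<le> \<epsilon>"
    unfolding nat_int by (simp add: algebra_simps)
  moreover have "0 < int (i + m)" "u \<le> real_of_int (int (i + m))" "real_of_int (int (i + m)) \<le> u + V \<epsilon>"
    using i m by auto
  ultimately show ?thesis by blast
qed

text \<open>An interval of length 2 V has a half on one side of 0: the right half if its midpoint is
  nonnegative, the left half otherwise. Since the columns k and -k carry the same values, the second
  case is the first one reflected, with slope - s.\<close>

lemma forest1_hits_line:
  fixes V :: "real \<Rightarrow> real" and a :: "nat \<Rightarrow> real" and c s u :: real
  assumes sud: "super_uniformly_dispersed V a" and eps: "\<epsilon> \<in> {0<..1}"
    and uv: "u + 2 * V \<epsilon> \<le> v"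
  shows "\<exists>x y. (x, y) \<in> forest1 a \<and> u \<le> x \<and> x \<le> v \<and> \<bar>(c + s * x) - y\<bar> \<le> \<epsilon>"
proof -
  have V: "V \<epsilon> > 0" using sud eps unfolding super_uniformly_dispersed_def by blast
  show ?thesis
  proof (cases "0 \<le> u + V \<epsilon>")
    case True
    from forest1_hits_line_right[OF sud eps this, of c s] obtain k l :: int where
      k: "0 < k" "u + V \<epsilon> \<le> k" "k \<le> u + V \<epsilon> + V \<epsilon>" "\<bar>(c + s * k) - (a (nat k) + l)\<bar> \<le> \<epsilon>"
      by blast
    have "(of_int k, a (nat k) + l) \<in> forest1 a"
    proof -
      have "(of_int k, a (nat \<bar>k\<bar>) + l) \<in> forest1 a" unfolding forest1_def using k(1) by blast
      then show ?thesis using k(1) by simp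
    qed
    moreover have "u \<le> of_int k" "of_int k \<le> v" using k(2,3) V uv by linarith+
    ultimately show ?thesis using k(4) by blast
  next
    case False
    then have "0 \<le> - (u + V \<epsilon>)" by simp
    from forest1_hits_line_right[OF sud eps this, of c "- s"] obtain k l :: int where
      k: "0 < k" "- (u + V \<epsilon>) \<le> k" "k \<le> - (u + V \<epsilon>) + V \<epsilon>"
         "\<bar>(c + - s * k) - (a (nat k) + l)\<bar> \<le> \<epsilon>"
      by blast
    have "(of_int (- k), a (nat \<bar>- k\<bar>) + l) \<in> forest1 a"
    proof -
      have "- k \<noteq> 0" using k(1) by simp
      then show ?thesis unfolding forest1_def by blast
    qed
    moreover have "u \<le> of_int (- k)" "of_int (- k) \<le> v" using k(2,3) V uv by simp_all
    moreover have "\<bar>(c + s * of_int (- k)) - (a (nat \<bar>- k\<bar>) + l)\<bar> \<le> \<epsilon>"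
      using k(1,4) by simp
    ultimately show ?thesis by blast
  qed
qed

text \<open>A segment that is wide horizontally is the graph of an affine function over an interval
  on which the line lemma applies; the vertical gap at the abscissa of the forest point bounds the
  distance.\<close>

lemma forest1_near_segment:
  assumes sud: "super_uniformly_dispersed V a" and eps: "\<epsilon> \<in> {0<..1}"
    and wide: "2 * V \<epsilon> \<le> \<bar>fst q - fst p\<bar>"
  shows "\<exists>x\<in>forest1 a. \<exists>z\<in>closed_segment p q. dist x z \<le> \<epsilon>"
  using wide
proof (induction "fst p" "fst q" arbitrary: p q rule: linorder_wlog)
  case (le p q)
  have V: "V \<epsilon> > 0" using sud eps unfolding super_uniformly_dispersed_def by blast
  define s where "s = (snd q - snd p) / (fst q - fst p)"
  have pos: "fst q - fst p > 0" using le V by simp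
  obtain x y where xy: "(x, y) \<in> forest1 a" "fst p \<le> x" "x \<le> fst q"
    and d: "\<bar>(snd p - s * fst p + s * x) - y\<bar> \<le> \<epsilon>"
    using forest1_hits_line[OF sud eps, of "fst p" "fst q" "snd p - s * fst p" s] le by auto
  \<comment> \<open>The convex parameter of the point of the segment with abscissa
    \<open>x\<close>.\<close>
  define r where "r = (x - fst p) / (fst q - fst p)"
  have r: "0 \<le> r" "r \<le> 1" unfolding r_def using xy pos by auto
  let ?z = "(x, snd p - s * fst p + s * x)"
  have "?z = (1 - r) *\<^sub>R p + r *\<^sub>R q"
  proof (rule prod_eqI)
    have "r * (fst q - fst p) = x - fst p" unfolding r_def using pos by simp
    then show "fst ?z = fst ((1 - r) *\<^sub>R p + r *\<^sub>R q)" by (simp add: algebra_simps)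
    have "s * (x - fst p) = r * (snd q - snd p)" unfolding s_def r_def by simp
    then show "snd ?z = snd ((1 - r) *\<^sub>R p + r *\<^sub>R q)" by (simp add: algebra_simps)
  qed
  then have "?z \<in> closed_segment p q" unfolding closed_segment_def using r by blast
  moreover have "dist (x, y) ?z \<le> \<epsilon>"
    using d by (simp add: dist_prod_def dist_real_def abs_minus_commute)
  ultimately show ?case using xy(1) by blast
next
  case (sym p q)
  then show ?case by (metis abs_minus_commute closed_segment_commute)
qed

text \<open>The length is at most the sum of the two coordinate widths, so one of them is at least 2
  V. If it is the vertical one, turning the segment by -\<pi>/2 makes it horizontal, and turning
  back carries \<open>forest1\<close> onto \<open>forest2\<close>.\<close>

lemma forest_near_segment:
  assumes sud: "super_uniformly_dispersed V a" and eps: "\<epsilon> \<in> {0<..1}"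
    and long: "4 * V \<epsilon> \<le> dist p q"
  shows "\<exists>x\<in>forest a. infdist x (closed_segment p q) \<le> \<epsilon>"
proof -
  have "\<exists>x\<in>forest a. \<exists>z\<in>closed_segment p q. dist x z \<le> \<epsilon>"
  proof (cases "2 * V \<epsilon> \<le> \<bar>fst q - fst p\<bar>")
    case True
    from forest1_near_segment[OF sud eps this] show ?thesis unfolding forest_def by blast
  next
    case False
    let ?rot = "\<lambda>(x::real, y::real). (- y, x)"
    let ?inv = "\<lambda>(x::real, y::real). (y, - x)"
    have "dist p q \<le> \<bar>fst q - fst p\<bar> + \<bar>snd q - snd p\<bar>"
      using sqrt_sum_squares_le_sum_abs[of "fst p - fst q" "snd p - snd q"]
      by (simp add: dist_prod_def dist_real_def abs_minus_commute)
    then have "2 * V \<epsilon> \<le> \<bar>fst (?inv q) - fst (?inv p)\<bar>"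
      using False long by (simp add: case_prod_unfold)
    from forest1_near_segment[OF sud eps this] obtain x z where
      x: "x \<in> forest1 a" and z: "z \<in> closed_segment (?inv p) (?inv q)" and d: "dist x z \<le> \<epsilon>"
      by blast
    have lin: "linear ?rot" by (rule linearI) (auto simp: case_prod_unfold)
    have "?rot z \<in> closed_segment (?rot (?inv p)) (?rot (?inv q))"
      using z closed_segment_linear_image[OF lin] by blast
    then have zin: "?rot z \<in> closed_segment p q" by (simp add: case_prod_unfold)
    have "dist (?rot x) (?rot z) = dist x z"
      by (simp add: dist_prod_def case_prod_unfold dist_real_def abs_minus_commute add.commute)
    then have "dist (?rot x) (?rot z) \<le> \<epsilon>" using d by simp
    moreover have "?rot x \<in> forest a" using x unfolding forest_def forest2_def by blast
    ultimately show ?thesis using zin by blast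
  qed
  then show ?thesis by (meson infdist_le2)
qed

theorem theorem1p0p3:
  "\<exists>a :: nat \<Rightarrow> real.
     (\<exists>V. near_inverse_square {0<..1} V \<and> super_uniformly_dispersed V a) \<and>
     (\<exists>W. near_inverse_square {0<..<1} W \<and> dense_forest (forest a) W)"
proof (intro exI conjI)
  show "super_uniformly_dispersed window dispersed_seq"
    by (rule super_uniformly_dispersed_seq)
  show "near_inverse_square {0<..1} window"
    using near_inverse_square_window[of "{0<..1}" 1] by simp
  \<comment> \<open>The 4 is a factor 2 for choosing the coordinate axis times a factor 2 for
    choosing the side of 0.\<close>
  show "near_inverse_square {0<..<1} (\<lambda>\<epsilon>. 4 * window \<epsilon>)"
    by (rule near_inverse_square_window) auto
  show "dense_forest (forest dispersed_seq) (\<lambda>\<epsilon>. 4 * window \<epsilon>)"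
    unfolding dense_forest_def visibility_function_def
  proof (intro conjI ballI allI impI finite_density_forest)
    show "antimono_on {0<..<1} (\<lambda>\<epsilon>. 4 * window \<epsilon>)"
      using antimono_window by (auto simp: monotone_on_def)
    show "filterlim (\<lambda>\<epsilon>. 4 * window \<epsilon>) at_top (at_right 0)"
      by (rule filterlim_tendsto_pos_mult_at_top[OF tendsto_const _ filterlim_window]) simp
    show "\<exists>x\<in>forest dispersed_seq. infdist x (closed_segment p q) \<le> \<epsilon>"
      if "\<epsilon> \<in> {0<..<1}" "dist p q = 4 * window \<epsilon>" for \<epsilon> p q
      using that by (intro forest_near_segment[OF super_uniformly_dispersed_seq]) auto
  qed (simp add: window_pos)
qed

end
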